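(* Let $V\subset\mathbb C$ be an open set such that for each $r>0$ the open set $\Omega_r:=\{z\in V\colon |z|>r\}$ is non-empty. Let $f,g\colon V\to\mathbb C$ be holomorphic functions such that: (a) $f(z)=g(z)(1+O(|z|^{-1}))$. (b) There are constants $0<c<C$ such that $c|z|\log|z|\le |g'(z)/g(z)|\le C|z|\log|z|$ for all $z\in V$. (c) Let $A=\{a\in V\colon f(a)=1\}$ and $B=\{b\in V\colon g(b)=1\}$. There exist two positive constants $r_0$ and $\rho_0$ such that if $w\in A\cup B$ satisfies $|w|>r_0$, then $\overline{D}(w,\rho_0)\subset V$. Then there is $R$ such that for any $b\in B$ with $|b|>R$ there is a unique $a\in A$ such that $|b-a|<|b|^{-2}$. The induced map $b\mapsto a$ (defined on $\{b\in B:|b|>R\}$) is injective, and its image contains all $a\in A$ with $|a|>R+1$.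
   Context: $\overline D(w,\rho_0)$ is the closed disc with center $w$ and radius $\rho_0$. Condition (a) means that there are constants $K,r_1>0$ and a function $\epsilon$ with $f(z)=g(z)(1+\epsilon(z))$ and $|\epsilon(z)|\le K/|z|$ for all $z\in V$ with $|z|>r_1$. *)

theory Defs
  imports "HOL-Complex_Analysis.Complex_Analysis"
begin

end

theory Submission
  imports Defs "HOL-Real_Asymp.Real_Asymp"
begin

text \<open>
  Near a large \<open>w \<in> A \<union> B\<close> the functions \<open>g\<close> and \<open>f\<close> have logarithms \<open>G\<close> and
  \<open>G + Ln (f / g)\<close>. By Cauchy's estimate their derivatives on the disc of radius
  \<open>2 |w|\<^sup>-\<^sup>2\<close> differ from \<open>g'(w)/g(w)\<close>, which has size \<open>|w| log |w|\<close>, by at most half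
  of its modulus. Each logarithm is therefore injective there, takes values of modulus less than
  \<open>2\<pi>\<close>, and is \<open>O(1/|w|)\<close> at \<open>w\<close>; so both equations \<open>f = 1\<close> and \<open>g = 1\<close> have exactly one
  solution in the disc, at distance \<open>O(1/(|w|\<^sup>2 log |w|))\<close> from \<open>w\<close>. The argument is symmetric
  in \<open>f\<close> and \<open>g\<close>, which gives injectivity and surjectivity of the correspondence.
\<close>

section \<open>Estimates on a single disc\<close>

lemma holomorphic_deriv_bound_half_ball:
  fixes f :: "complex \<Rightarrow> complex"
  assumes "f holomorphic_on ball w \<rho>" "\<And>z. z \<in> ball w \<rho> \<Longrightarrow> norm (f z) \<le> M"
    and "\<rho> > 0" "dist w z \<le> \<rho> / 2"
  shows "norm (deriv f z) \<le> 4 * M / \<rho>"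
proof -
  \<comment> \<open>A point within \<open>\<rho> / 2\<close> of \<open>w\<close> still has room for
    a circle of radius \<open>\<rho> / 4\<close>; Cauchy's inequality on that circle produces the
    factor 4.\<close>
  have sub: "cball z (\<rho>/4) \<subseteq> ball w \<rho>"
  proof
    fix x assume "x \<in> cball z (\<rho>/4)"
    then show "x \<in> ball w \<rho>"
      using assms(3,4) dist_triangle[of w x z] by simp
  qed
  have "norm ((deriv ^^ 1) f z) \<le> fact 1 * M / (\<rho>/4) ^ 1"
  proof (rule Cauchy_inequality)
    show "f holomorphic_on ball z (\<rho>/4)"
      by (rule holomorphic_on_subset[OF assms(1)]) (use sub ball_subset_cball in blast)
    show "continuous_on (cball z (\<rho>/4)) f"
      by (rule holomorphic_on_imp_continuous_on, rule holomorphic_on_subset[OF assms(1) sub])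
    show "norm (f x) \<le> M" if "norm (z - x) = \<rho>/4" for x
    proof (rule assms(2))
      have "x \<in> cball z (\<rho>/4)" using that by (simp add: dist_norm)
      then show "x \<in> ball w \<rho>" using sub by blast
    qed
  qed (use assms(3) in auto)
  then show ?thesis by (simp add: field_simps)
qed

text \<open>Newton's iteration with fixed slope, \<open>z - L z / D\<close>, contracts by 1/2
  because \<open>L'\<close> stays within \<open>norm D / 2\<close> of \<open>D\<close>; its fixed
  points are the zeros of \<open>L\<close>. Two radii are kept apart: the solution is located in the
  small disc of radius \<open>s\<close>, but is unique in the larger one of radius \<open>r\<close>.
  The bound \<open>small\<close> permits the return from \<open>exp (L z) = 1\<close> to
  \<open>L z = 0\<close>.\<close>

lemma near_linear_zero:
  fixes L L' :: "complex \<Rightarrow> complex"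
  assumes L: "\<And>z. z \<in> cball w r \<Longrightarrow> (L has_field_derivative L' z) (at z)"
    and D: "D \<noteq> 0" "\<And>z. z \<in> cball w r \<Longrightarrow> norm (L' z - D) \<le> norm D / 2"
    and s: "norm (L w) \<le> norm D * s / 2" "0 \<le> s" "s \<le> r"
    and small: "norm (L w) + 3 / 2 * norm D * r < 2 * pi"
  shows "\<exists>z\<in>cball w s. exp (L z) = 1"
    and "\<lbrakk>z1 \<in> cball w r; z2 \<in> cball w r; exp (L z1) = 1; exp (L z2) = 1\<rbrakk> \<Longrightarrow> z1 = z2"
proof -
  define T where "T = (\<lambda>z. z - L z / D)"
  have w: "w \<in> cball w r" using s by simp
  have T: "norm (T x - T y) \<le> 1 / 2 * norm (x - y)" if "x \<in> cball w r" "y \<in> cball w r" for x y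
  proof (rule field_differentiable_bound[OF convex_cball[of w r] _ _ that])
    fix z assume z: "z \<in> cball w r"
    show "(T has_field_derivative 1 - L' z / D) (at z within cball w r)"
      unfolding T_def using D(1)
      by (auto intro!: derivative_eq_intros has_field_derivative_at_within[OF L[OF z]])
    have "norm (1 - L' z / D) = norm (L' z - D) / norm D"
      using D(1) by (simp add: norm_minus_commute diff_divide_distrib flip: norm_divide)
    also have "\<dots> \<le> (norm D / 2) / norm D"
      using D(2)[OF z] by (intro divide_right_mono) auto
    finally show "norm (1 - L' z / D) \<le> 1 / 2" using D(1) by simp
  qed
  \<comment> \<open>The first Newton correction uses up half of \<open>s\<close> and the contraction
    the other half, so \<open>T\<close> maps the disc of radius \<open>s\<close> into
    itself.\<close>
  have Tw: "norm (T w - w) \<le> s / 2"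
    using s(1) D(1) by (simp add: T_def norm_divide divide_simps mult_ac)
  have "\<exists>!x. x \<in> cball w s \<and> T x = x"
  proof (rule Banach_fix)
    show "complete (cball w s)" by (simp add: complete_eq_closed)
    show "T ` cball w s \<subseteq> cball w s"
    proof (intro image_subsetI)
      fix z assume z: "z \<in> cball w s"
      then have "norm (T z - T w) \<le> 1 / 2 * norm (z - w)"
        using T w s by auto
      moreover have "norm (z - w) \<le> s" using z by (simp add: dist_norm norm_minus_commute)
      moreover have "norm (T z - w) \<le> norm (T z - T w) + norm (T w - w)"
        using norm_triangle_ineq[of "T z - T w" "T w - w"] by simp
      ultimately show "T z \<in> cball w s"
        using Tw by (simp add: dist_norm norm_minus_commute)
    qed
    show "dist (T x) (T y) \<le> (1/2) * dist x y" if "x \<in> cball w s" "y \<in> cball w s" for x y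
      using T[of x y] that s by (simp add: dist_norm)
  qed (use s in auto)
  then obtain z where z: "z \<in> cball w s" "T z = z" by blast
  then have "L z = 0" using D(1) by (simp add: T_def)
  with z show "\<exists>z\<in>cball w s. exp (L z) = 1" by force
  \<comment> \<open>The derivative is at most \<open>3 / 2 * norm D\<close>, which keeps
    \<open>L\<close> below \<open>2 * pi\<close> in modulus on the whole disc; 0 is the only integer
    multiple of \<open>2 * pi * \<i>\<close> of that size.\<close>
  have zero: "L z = 0" if z: "z \<in> cball w r" and "exp (L z) = 1" for z
  proof -
    have "norm (L z - L w) \<le> 3 / 2 * norm D * norm (z - w)"
    proof (rule field_differentiable_bound[OF convex_cball[of w r] _ _ z w])
      fix x assume x: "x \<in> cball w r"
      show "(L has_field_derivative L' x) (at x within cball w r)"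
        by (rule has_field_derivative_at_within[OF L[OF x]])
      show "norm (L' x) \<le> 3 / 2 * norm D"
        using D(2)[OF x] norm_triangle_ineq[of "L' x - D" D] by simp
    qed
    also have "\<dots> \<le> 3 / 2 * norm D * r"
      using z by (intro mult_left_mono) (auto simp: dist_norm norm_minus_commute)
    finally have *: "norm (L z) < 2 * pi"
      using small norm_triangle_ineq[of "L z - L w" "L w"] by simp
    from \<open>exp (L z) = 1\<close> obtain n :: int where n: "Re (L z) = 0" "Im (L z) = of_int (2 * n) * pi"
      by (auto simp: exp_eq_1)
    have "\<bar>of_int (2 * n) * pi\<bar> < 2 * pi"
      using * abs_Im_le_cmod[of "L z"] n by linarith
    then have "\<bar>real_of_int n\<bar> < 1" by (simp add: abs_mult)
    then have "n = 0" by linarith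
    with n show ?thesis by (simp add: complex_eq_iff)
  qed
  show "z1 = z2" if z: "z1 \<in> cball w r" "z2 \<in> cball w r" and e: "exp (L z1) = 1" "exp (L z2) = 1"
  proof -
    have "norm (z1 - z2) \<le> 1 / 2 * norm (z1 - z2)"
      using T[OF z] zero[OF z(1) e(1)] zero[OF z(2) e(2)] by (simp add: T_def)
    then show ?thesis by simp
  qed
qed

text \<open>Intended for \<open>u = g\<close> and \<open>q = f / g\<close>. Adding a small logarithm
  \<open>e\<close> of \<open>q\<close> to a logarithm \<open>G\<close> of \<open>u\<close> treats
  both equations at once, and \<open>w\<close> may solve either of them, so all four combinations of
  centre and target are served. The bound \<open>m\<close> makes the slope at \<open>w\<close>
  large, while \<open>M\<close> controls its variation over the disc.\<close>

lemma nearby_unit_values: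
  fixes u q :: "complex \<Rightarrow> complex"
  assumes u: "u holomorphic_on ball w \<rho>" "\<And>z. z \<in> ball w \<rho> \<Longrightarrow> u z \<noteq> 0"
    and q: "q holomorphic_on ball w \<rho>" "\<And>z. z \<in> ball w \<rho> \<Longrightarrow> norm (q z - 1) \<le> \<kappa>" "\<kappa> < 1 / 2"
    and m: "0 < m" "m \<le> norm (deriv u w / u w)"
    and M: "\<And>z. z \<in> ball w \<rho> \<Longrightarrow> norm (deriv u z / u z) \<le> M"
    and r: "0 < r" "r \<le> \<rho> / 2"
    and small: "4 * M / \<rho> * r + 4 / \<rho> \<le> m / 2" "4 * \<kappa> / m \<le> r" "2 * \<kappa> + 3 / 2 * M * r < 2 * pi"
    and w: "u w = 1 \<or> u w * q w = 1"
    and v: "v = u \<or> v = (\<lambda>z. u z * q z)"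
  shows "\<exists>z\<in>cball w (4 * \<kappa> / m). v z = 1"
    and "\<lbrakk>z1 \<in> cball w r; z2 \<in> cball w r; v z1 = 1; v z2 = 1\<rbrakk> \<Longrightarrow> z1 = z2"
proof -
  have \<rho>: "\<rho> > 0" using r by simp
  have wb: "w \<in> ball w \<rho>" using \<rho> by simp
  have \<kappa>: "\<kappa> \<ge> 0" using q(2)[OF wb] norm_ge_zero order_trans by blast
  define e where "e = (\<lambda>z. Ln (q z))"
  define h where "h = (\<lambda>z. deriv u z / u z)"
  have Re_q: "Re (q z) > 0" if "z \<in> ball w \<rho>" for z
    using q(2)[OF that] q(3) abs_Re_le_cmod[of "q z - 1"] by simp
  then have q_pos: "q z \<notin> \<real>\<^sub>\<le>\<^sub>0" "q z \<noteq> 0" if "z \<in> ball w \<rho>" for z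
    using that by (fastforce simp: complex_nonpos_Reals_iff)+
  have e_holo: "e holomorphic_on ball w \<rho>"
    unfolding e_def using q(1) q_pos by (intro holomorphic_intros) auto
  have exp_e: "exp (e z) = q z" if "z \<in> ball w \<rho>" for z
    using q_pos[OF that] by (simp add: e_def)
  have e_le: "norm (e z) \<le> 2 * \<kappa>" if "z \<in> ball w \<rho>" for z
  proof -
    have "norm (Ln (1 + (q z - 1))) \<le> 2 * norm (q z - 1)"
      by (rule norm_Ln_le) (use q(2)[OF that] q(3) in linarith)
    then show ?thesis using q(2)[OF that] by (simp add: e_def)
  qed
  obtain G0 where G0: "G0 holomorphic_on ball w \<rho>" "\<And>z. z \<in> ball w \<rho> \<Longrightarrow> u z = exp (G0 z)"
    using contractible_imp_holomorphic_log[OF u(1) convex_imp_contractible[OF convex_ball] u(2)]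
    by blast
  \<comment> \<open>The branch is normalised so that the logarithm of whichever function equals 1 at
    \<open>w\<close> vanishes there. The logarithm of the other one is then \<open>e w\<close> or
    \<open>- e w\<close> at \<open>w\<close>, hence at most \<open>2 * \<kappa>\<close> in
    modulus.\<close>
  define k where "k = (if u w = 1 then G0 w else G0 w + e w)"
  define G where "G = (\<lambda>z. G0 z - k)"
  have "exp k = 1"
    using w G0(2)[OF wb] exp_e[OF wb] by (auto simp: k_def exp_add)
  then have exp_G: "exp (G z) = u z" if "z \<in> ball w \<rho>" for z
    using G0(2)[OF that] by (simp add: G_def exp_diff)
  have G_holo: "G holomorphic_on ball w \<rho>"
    unfolding G_def using G0(1) by (intro holomorphic_intros)
  have h_holo: "h holomorphic_on ball w \<rho>"
    unfolding h_def using u by (intro holomorphic_intros) auto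
  \<comment> \<open>Differentiating \<open>exp G = u\<close> gives \<open>G' = u' / u\<close>, which
    is how the bounds on the logarithmic derivative enter.\<close>
  have dG: "(G has_field_derivative h z) (at z)" if z: "z \<in> ball w \<rho>" for z
  proof -
    have d: "(G has_field_derivative deriv G z) (at z)"
      using G_holo z holomorphic_derivI open_ball by blast
    have "((\<lambda>z. exp (G z)) has_field_derivative u z * deriv G z) (at z)"
      using DERIV_fun_exp[OF d] exp_G[OF z] by simp
    then have "(u has_field_derivative u z * deriv G z) (at z)"
      by (rule has_field_derivative_transform_within_open[OF _ open_ball z exp_G])
    from DERIV_imp_deriv[OF this] have "h z = deriv G z" using u(2)[OF z] by (simp add: h_def)
    then show ?thesis using d by simp
  qed
  have de: "(e has_field_derivative deriv e z) (at z)" if "z \<in> ball w \<rho>" for z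
    using e_holo that holomorphic_derivI open_ball by blast
  have sub: "z \<in> ball w \<rho>" if "z \<in> cball w r" for z
    using that r by auto
  have half: "dist w z \<le> \<rho> / 2" if "z \<in> cball w r" for z
    using that r by auto
  have M0: "norm (h z) \<le> M" if "z \<in> ball w \<rho>" for z
    using M[OF that] by (simp add: h_def)
  have M_nonneg: "M \<ge> 0" using M0[OF wb] norm_ge_zero order_trans by blast
  \<comment> \<open>Cauchy's estimate for \<open>deriv h\<close>, followed by the mean value
    inequality.\<close>
  have h_diff: "norm (h z - h w) \<le> 4 * M / \<rho> * r" if z: "z \<in> cball w r" for z
  proof -
    have "norm (h z - h w) \<le> 4 * M / \<rho> * norm (z - w)"
    proof (rule field_differentiable_bound[OF convex_cball[of w r] _ _ z])
      fix x assume x: "x \<in> cball w r"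
      show "(h has_field_derivative deriv h x) (at x within cball w r)"
        using h_holo sub[OF x] by (meson holomorphic_derivI open_ball has_field_derivative_at_within)
      show "norm (deriv h x) \<le> 4 * M / \<rho>"
        by (rule holomorphic_deriv_bound_half_ball[OF h_holo M0 \<rho> half[OF x]])
    qed (use r in auto)
    also have "\<dots> \<le> 4 * M / \<rho> * r"
      using z M_nonneg \<rho> by (intro mult_left_mono) (auto simp: dist_norm norm_minus_commute)
    finally show ?thesis .
  qed
  have e'_le: "norm (deriv e z) \<le> 4 / \<rho>" if z: "z \<in> cball w r" for z
  proof -
    \<comment> \<open>As \<open>2 * \<kappa> < 1\<close>, the crude bound 1 is enough: the factor
      \<open>q\<close> costs only the constant \<open>4 / \<rho>\<close> in the slope.\<close>
    have "norm (e z) \<le> 1" if "z \<in> ball w \<rho>" for z using e_le[OF that] q(3) by simp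
    from holomorphic_deriv_bound_half_ball[OF e_holo this \<rho> half[OF z]] show ?thesis by simp
  qed
  have D: "m \<le> norm (h w)" "h w \<noteq> 0" using m by (auto simp: h_def)
  have Gw: "norm (G w) \<le> 2 * \<kappa>" "norm (G w + e w) \<le> 2 * \<kappa>"
    using e_le[OF wb] \<kappa> by (auto simp: G_def k_def)
  \<comment> \<open>Origin of the radius \<open>4 * \<kappa> / m\<close>: it is twice the bound
    \<open>2 * \<kappa>\<close> on the logarithm at \<open>w\<close>, divided by the lower bound
    \<open>m\<close> on the slope.\<close>
  have "2 * \<kappa> = m * (4 * \<kappa> / m) / 2" using m(1) by simp
  also have "\<dots> \<le> norm (h w) * (4 * \<kappa> / m) / 2"
    using D(1) \<kappa> m(1) by (intro divide_right_mono mult_right_mono) auto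
  finally have s: "2 * \<kappa> \<le> norm (h w) * (4 * \<kappa> / m) / 2" .
  have "3 / 2 * norm (h w) * r \<le> 3 / 2 * M * r"
    using M0[OF wb] r by (intro mult_right_mono mult_left_mono) auto
  then have small': "2 * \<kappa> + 3 / 2 * norm (h w) * r < 2 * pi" using small(3) by linarith
  \<comment> \<open>The reference slope is \<open>h w\<close> for both targets; for
    \<open>G + e\<close> the derivative of \<open>e\<close> is counted as part of the error.\<close>
  obtain L L' where L: "\<And>z. z \<in> cball w r \<Longrightarrow> (L has_field_derivative L' z) (at z)"
    "\<And>z. z \<in> cball w r \<Longrightarrow> norm (L' z - h w) \<le> norm (h w) / 2"
    "norm (L w) \<le> 2 * \<kappa>" "\<And>z. z \<in> ball w \<rho> \<Longrightarrow> exp (L z) = v z"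
  proof (cases "v = u")
    case True
    have "norm (h z - h w) \<le> norm (h w) / 2" if "z \<in> cball w r" for z
    proof -
      have "4 / \<rho> > 0" using \<rho> by simp
      then show ?thesis using h_diff[OF that] small(1) D(1) by linarith
    qed
    then show ?thesis
      using that[of G h] dG sub Gw(1) exp_G True by blast
  next
    case False
    have "norm (h z + deriv e z - h w) \<le> norm (h w) / 2" if "z \<in> cball w r" for z
    proof -
      have "norm (h z + deriv e z - h w) \<le> norm (h z - h w) + norm (deriv e z)"
        using norm_triangle_ineq[of "h z - h w" "deriv e z"] by (simp add: algebra_simps)
      then show ?thesis using h_diff[OF that] e'_le[OF that] small(1) D(1) by linarith
    qed
    moreover have "exp (G z + e z) = v z" if "z \<in> ball w \<rho>" for z
      using v False exp_G[OF that] exp_e[OF that] by (auto simp: exp_add)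
    ultimately show ?thesis
      using that[of "\<lambda>z. G z + e z" "\<lambda>z. h z + deriv e z"] DERIV_add[OF dG de] sub Gw(2) by blast
  qed
  have s0: "0 \<le> 4 * \<kappa> / m" using \<kappa> m(1) by simp
  have Lw: "norm (L w) \<le> norm (h w) * (4 * \<kappa> / m) / 2"
    "norm (L w) + 3 / 2 * norm (h w) * r < 2 * pi"
    using L(3) s small' by linarith+
  note NL = near_linear_zero[of w r L L' "h w" "4 * \<kappa> / m", OF L(1) D(2) L(2) Lw(1) s0 small(2) Lw(2)]
  obtain z where z: "z \<in> cball w (4 * \<kappa> / m)" "exp (L z) = 1" using NL(1) by blast
  moreover have "z \<in> ball w \<rho>" using z(1) small(2) by (intro sub) auto
  ultimately show "\<exists>z\<in>cball w (4 * \<kappa> / m). v z = 1" using L(4) by force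
  show "z1 = z2" if "z1 \<in> cball w r" "z2 \<in> cball w r" "v z1 = 1" "v z2 = 1"
    using NL(2)[of z1 z2] that L(4) sub by simp
qed

theorem theorem9:
  fixes V A B :: "complex set" and f g :: "complex \<Rightarrow> complex"
  assumes V_open: "open V"
    and V_unbounded: "\<And>r::real. r > 0 \<Longrightarrow> {z \<in> V. norm z > r} \<noteq> {}"
    and f_holo: "f holomorphic_on V"
    and g_holo: "g holomorphic_on V"
    and a: "\<exists>K r1 :: real. \<exists>\<epsilon> :: complex \<Rightarrow> complex. K > 0 \<and> r1 > 0 \<and>
        (\<forall>z\<in>V. norm z > r1 \<longrightarrow>
          f z = g z * (1 + \<epsilon> z) \<and> norm (\<epsilon> z) \<le> K / norm z)"
    and b: "\<exists>c C :: real. 0 < c \<and> c < C \<and>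
        (\<forall>z\<in>V. c * norm z * ln (norm z) \<le> norm (deriv g z / g z) \<and>
               norm (deriv g z / g z) \<le> C * norm z * ln (norm z))"
    and A_def: "A = {a \<in> V. f a = 1}"
    and B_def: "B = {b \<in> V. g b = 1}"
    and c: "\<exists>r0 \<rho>0 :: real. r0 > 0 \<and> \<rho>0 > 0 \<and>
        (\<forall>w \<in> A \<union> B. norm w > r0 \<longrightarrow> cball w \<rho>0 \<subseteq> V)"
  shows "\<exists>R :: real.
      (\<forall>b\<in>B. norm b > R \<longrightarrow> (\<exists>!a. a \<in> A \<and> norm (b - a) < norm b powi (-2))) \<and>
      (let \<phi> = (\<lambda>b. THE a. a \<in> A \<and> norm (b - a) < norm b powi (-2)) in
        inj_on \<phi> {b \<in> B. norm b > R} \<and>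
        {a \<in> A. norm a > R + 1} \<subseteq> \<phi> ` {b \<in> B. norm b > R})"
proof -

  \<comment> \<open>Uniform constants and solutions near one point\<close>
  obtain K r1 \<epsilon> where K: "K > 0" "r1 > 0"
    and f_eq: "\<And>z. z \<in> V \<Longrightarrow> norm z > r1 \<Longrightarrow> f z = g z * (1 + \<epsilon> z)"
    and \<epsilon>: "\<And>z. z \<in> V \<Longrightarrow> norm z > r1 \<Longrightarrow> norm (\<epsilon> z) \<le> K / norm z"
    using a by blast
  obtain c C where cC: "0 < c" "c < C"
    and lower: "\<And>z. z \<in> V \<Longrightarrow> c * norm z * ln (norm z) \<le> norm (deriv g z / g z)"
    and upper: "\<And>z. z \<in> V \<Longrightarrow> norm (deriv g z / g z) \<le> C * norm z * ln (norm z)"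
    using b by blast
  obtain r0 \<rho>0 where "r0 > 0" "\<rho>0 > 0"
    and disc0: "\<And>w. w \<in> A \<union> B \<Longrightarrow> norm w > r0 \<Longrightarrow> cball w \<rho>0 \<subseteq> V"
    using c by blast
  \<comment> \<open>Capping the radius at 1 keeps \<open>norm z\<close> within 1 of
    \<open>norm w\<close> on the disc; this explains the argument \<open>x + 1\<close> in
    \<open>M\<close> below.\<close>
  define \<rho> where "\<rho> = min \<rho>0 1"
  have \<rho>: "0 < \<rho>" "\<rho> \<le> 1" using \<open>\<rho>0 > 0\<close> by (auto simp: \<rho>_def)
  have C: "C > 0" using cC by simp
  define m where "m = (\<lambda>x. c * x * ln x)"
  define M where "M = (\<lambda>x. C * (x + 1) * ln (x + 1))"
  \<comment> \<open>These are the smallness conditions for \<open>\<kappa> = 2 * K / x\<close> and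
    \<open>r = 2 / x^2\<close>. Here \<open>M x * r\<close> is of order \<open>ln x / x\<close>, and
    \<open>m x\<close> outgrows the constant \<open>4 / \<rho>\<close>. The location radius is
    \<open>8 * K / (c * x^2 * ln x)\<close>; its logarithm brings it below
    \<open>1 / (2 * x^2)\<close> whatever \<open>K\<close> and \<open>c\<close> are.\<close>
  have "\<forall>\<^sub>F x::real in at_top. x > r0 \<and> x > r1 + 1 \<and> x > 3 \<and> 2 * K / x < 1 / 2 \<and>
      2 / x\<^sup>2 \<le> \<rho> / 2 \<and> 4 * M x / \<rho> * (2 / x\<^sup>2) + 4 / \<rho> \<le> m x / 2 \<and>
      4 * (2 * K / x) / m x < 1 / (2 * x\<^sup>2) \<and> 2 * (2 * K / x) + 3 / 2 * M x * (2 / x\<^sup>2) < 2 * pi"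
    unfolding m_def M_def
    using K \<rho> C \<open>0 < c\<close> pi_gt_zero
    by (intro eventually_conj; real_asymp)
  then obtain R where R: "\<And>x. x \<ge> R \<Longrightarrow> x > r0 \<and> x > r1 + 1 \<and> x > 3 \<and> 2 * K / x < 1 / 2 \<and>
      2 / x\<^sup>2 \<le> \<rho> / 2 \<and> 4 * M x / \<rho> * (2 / x\<^sup>2) + 4 / \<rho> \<le> m x / 2 \<and>
      4 * (2 * K / x) / m x < 1 / (2 * x\<^sup>2) \<and> 2 * (2 * K / x) + 3 / 2 * M x * (2 / x\<^sup>2) < 2 * pi"
    by (auto simp: eventually_at_top_linorder)
  have R3: "R > 3" using R[of R] by simp
  \<comment> \<open>The radii lie on either side of the required \<open>1 / (norm w)^2\<close>. The
    smaller one leaves slack for exchanging the roles of \<open>a\<close> and \<open>b\<close> in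
    surjectivity; the larger one accommodates two points that share an image, for
    injectivity.\<close>
  have local_solutions: "\<exists>z\<in>P. norm (w - z) < 1 / (2 * (norm w)\<^sup>2)" (is ?ex)
      "\<And>z1 z2. \<lbrakk>z1 \<in> P; z2 \<in> P; norm (w - z1) \<le> 2 / (norm w)\<^sup>2; norm (w - z2) \<le> 2 / (norm w)\<^sup>2\<rbrakk>
         \<Longrightarrow> z1 = z2"
    if w: "w \<in> A \<union> B" "norm w > R" and P: "P = A \<or> P = B" for w P
  proof -
    define x where "x = norm w"
    have x: "x > r0" "x > r1 + 1" "x > 3" "2 * K / x < 1 / 2"
      "2 / x\<^sup>2 \<le> \<rho> / 2" "4 * M x / \<rho> * (2 / x\<^sup>2) + 4 / \<rho> \<le> m x / 2"
      "4 * (2 * K / x) / m x < 1 / (2 * x\<^sup>2)" "2 * (2 * K / x) + 3 / 2 * M x * (2 / x\<^sup>2) < 2 * pi"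
      using R[of x] w(2) by (auto simp: x_def)
    have subV: "z \<in> V" if "z \<in> ball w \<rho>" for z
      using disc0[OF w(1)] x(1) that by (auto simp: x_def \<rho>_def subset_iff)
    have z_le: "norm z < x + 1" "x - 1 < norm z" if "z \<in> ball w \<rho>" for z
      using that \<rho>(2) norm_triangle_ineq2[of z w] norm_triangle_ineq2[of w z]
      by (auto simp: x_def dist_norm norm_minus_commute)
    \<comment> \<open>Division by zero yields 0, so a zero of \<open>g\<close> here would contradict
      the positive lower bound on the logarithmic derivative.\<close>
    have g_nz: "g z \<noteq> 0" if "z \<in> V" "norm z > 1" for z
      using lower[OF that(1)] ln_gt_zero[OF that(2)] that(2) \<open>0 < c\<close> by (auto simp: mult_le_0_iff)
    have g0: "g z \<noteq> 0" if "z \<in> ball w \<rho>" for z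
      using g_nz[OF subV[OF that]] z_le[OF that] x(3) by simp
    have ball_V: "ball w \<rho> \<subseteq> V" using subV by blast
    have w_in: "w \<in> ball w \<rho>" using \<rho> by simp
    define q where "q = (\<lambda>z. f z / g z)"
    have q_holo: "q holomorphic_on ball w \<rho>"
      unfolding q_def using g0 holomorphic_on_subset[OF f_holo ball_V] holomorphic_on_subset[OF g_holo ball_V]
      by (intro holomorphic_intros) auto
    have fgq: "f z = g z * q z" if "z \<in> ball w \<rho>" for z using g0[OF that] by (simp add: q_def)
    have q_le: "norm (q z - 1) \<le> 2 * K / x" if z: "z \<in> ball w \<rho>" for z
    proof -
      have "norm z > r1" using z_le[OF z] x by simp
      then have "norm (q z - 1) \<le> K / norm z"
        using f_eq[OF subV[OF z]] \<epsilon>[OF subV[OF z]] g0[OF z] by (simp add: q_def)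
      \<comment> \<open>From \<open>x > 3\<close>, \<open>norm z > x - 1 > x / 2\<close>; hence the
        factor 2 in \<open>\<kappa>\<close>.\<close>
      also have "\<dots> \<le> K / (x / 2)" using z_le[OF z] x(3) K(1) by (intro frac_le) auto
      finally show ?thesis by (simp add: mult_ac)
    qed
    have m_pos: "m x > 0" using \<open>0 < c\<close> x(3) by (simp add: m_def)
    have m_le: "m x \<le> norm (deriv g w / g w)" using lower[OF subV[OF w_in]] by (simp add: m_def x_def)
    have M_ge: "norm (deriv g z / g z) \<le> M x" if z: "z \<in> ball w \<rho>" for z
    proof -
      have "norm (deriv g z / g z) \<le> C * norm z * ln (norm z)" by (rule upper[OF subV[OF z]])
      also have "\<dots> \<le> C * (x + 1) * ln (x + 1)"
        using z_le[OF z] x(3) C by (intro mult_mono ln_mono) auto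
      finally show ?thesis by (simp add: M_def)
    qed
    have w1: "g w = 1 \<or> g w * q w = 1"
      using w(1) fgq[OF w_in] by (auto simp: A_def B_def)
    have r: "0 < 2 / x\<^sup>2" using x(3) by simp
    have "1 / (2 * x\<^sup>2) \<le> 2 / x\<^sup>2" by (simp add: divide_simps)
    with x(7) have s: "4 * (2 * K / x) / m x \<le> 2 / x\<^sup>2" by linarith
    define v where "v = (if P = B then g else (\<lambda>z. g z * q z))"
    have v: "v = g \<or> v = (\<lambda>z. g z * q z)" by (simp add: v_def)
    have P_iff: "z \<in> P \<longleftrightarrow> v z = 1" if "z \<in> ball w \<rho>" for z
      using P subV[OF that] fgq[OF that] by (auto simp: v_def A_def B_def)
    have r_sub: "z \<in> ball w \<rho>" if "norm (w - z) \<le> 2 / x\<^sup>2" for z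
      using that x(5) \<rho>(1) by (simp add: dist_norm)
    note U = nearby_unit_values[OF holomorphic_on_subset[OF g_holo ball_V] g0 q_holo q_le x(4)
        m_pos m_le M_ge r x(5,6) s x(8) w1 v]
    obtain z where z: "z \<in> cball w (4 * (2 * K / x) / m x)" "v z = 1" using U(1) by blast
    have "norm (w - z) < 1 / (2 * x\<^sup>2)" "norm (w - z) \<le> 2 / x\<^sup>2"
      using z(1) x(7) s by (auto simp: dist_norm)
    with z(2) P_iff r_sub show ?ex unfolding x_def by blast
    show "z1 = z2" if "z1 \<in> P" "z2 \<in> P" "norm (w - z1) \<le> 2 / (norm w)\<^sup>2" "norm (w - z2) \<le> 2 / (norm w)\<^sup>2"
      for z1 z2
      using U(2)[of z1 z2] that P_iff r_sub by (simp add: x_def dist_norm)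
  qed

  \<comment> \<open>The correspondence between solutions\<close>
  have powi: "norm w powi (-2) = 1 / (norm w)\<^sup>2" for w :: complex
    by (simp add: power_int_minus divide_simps)
  have ex1: "\<exists>!a. a \<in> A \<and> norm (b - a) < norm b powi (-2)" if bB: "b \<in> B" "norm b > R" for b
  proof -
    have b: "b \<in> A \<union> B" using bB by simp
    have le: "1 / (2 * (norm b)\<^sup>2) \<le> 1 / (norm b)\<^sup>2" "1 / (norm b)\<^sup>2 \<le> 2 / (norm b)\<^sup>2"
      by (simp_all add: divide_simps)
    obtain z where "z \<in> A" "norm (b - z) < 1 / (2 * (norm b)\<^sup>2)"
      using local_solutions(1)[OF b bB(2), of A] by blast
    then show ?thesis
      unfolding powi using le local_solutions(2)[OF b bB(2), of A]
      by (intro ex1I[of _ z]) (auto intro: less_imp_le order.trans)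
  qed
  define \<phi> where "\<phi> = (\<lambda>b. THE a. a \<in> A \<and> norm (b - a) < norm b powi (-2))"
  have \<phi>: "\<phi> b \<in> A" "norm (b - \<phi> b) < 1 / (norm b)\<^sup>2" if "b \<in> B" "norm b > R" for b
    using theI'[OF ex1[OF that]] by (simp_all add: \<phi>_def powi)
  have \<phi>_eq: "\<phi> b = a" if "b \<in> B" "norm b > R" "a \<in> A" "norm (b - a) < 1 / (norm b)\<^sup>2" for a b
    unfolding \<phi>_def using ex1[OF that(1,2)] that(3,4) by (intro the1_equality) (auto simp: powi)
  \<comment> \<open>With the moduli ordered, both points are within \<open>1 / (norm b1)^2\<close>
    of their common image, so \<open>b2\<close> falls in the uniqueness disc of \<open>b1\<close>
    for the set \<open>B\<close>.\<close>
  have inj_le: "b1 = b2"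
    if b: "b1 \<in> B" "norm b1 > R" "b2 \<in> B" "norm b2 > R" "\<phi> b1 = \<phi> b2" and le: "norm b1 \<le> norm b2" for b1 b2
  proof -
    have "norm (b1 - b2) \<le> norm (b1 - \<phi> b1) + norm (b2 - \<phi> b2)"
      using norm_triangle_ineq[of "b1 - \<phi> b1" "\<phi> b2 - b2"] b(5) by (simp add: norm_minus_commute)
    also have "\<dots> \<le> 1 / (norm b1)\<^sup>2 + 1 / (norm b2)\<^sup>2"
      using \<phi>(2)[OF b(1,2)] \<phi>(2)[OF b(3,4)] by simp
    also have "1 / (norm b2)\<^sup>2 \<le> 1 / (norm b1)\<^sup>2"
      using le b(2) R3 by (intro divide_left_mono power_mono mult_pos_pos zero_less_power) auto
    finally have "norm (b1 - b2) \<le> 2 / (norm b1)\<^sup>2" by simp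
    then show ?thesis using local_solutions(2)[of b1 B b1 b2] b by simp
  qed
  have "inj_on \<phi> {b \<in> B. norm b > R}"
  proof (rule inj_onI)
    fix b1 b2 assume "b1 \<in> {b \<in> B. norm b > R}" "b2 \<in> {b \<in> B. norm b > R}" "\<phi> b1 = \<phi> b2"
    then show "b1 = b2"
      using inj_le[of b1 b2] inj_le[of b2 b1] linear[of "norm b1" "norm b2"] by auto
  qed
  \<comment> \<open>The local result is now centred at \<open>a\<close> with target
    \<open>B\<close>. The point found is within 1 of \<open>a\<close>, so
    \<open>norm a > R + 1\<close> forces \<open>norm b > R\<close>.\<close>
  moreover have "a \<in> \<phi> ` {b \<in> B. norm b > R}" if a: "a \<in> A" "norm a > R + 1" for a
  proof -
    obtain b where b: "b \<in> B" "norm (a - b) < 1 / (2 * (norm a)\<^sup>2)"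
      using local_solutions(1)[of a B] a by auto
    have "1 \<le> (norm a)\<^sup>2" using a(2) R3 by (intro one_le_power) simp
    then have "1 / (2 * (norm a)\<^sup>2) \<le> 1" by (simp add: divide_simps)
    then have d1: "norm (a - b) < 1" using b(2) by simp
    then have bR: "norm b > R" using a(2) norm_triangle_ineq2[of a b] by simp
    \<comment> \<open>Since \<open>norm a > 4\<close>, the error 1 is below
      \<open>norm a / 4\<close>; and \<open>(5 / 4)^2 < 2\<close> lets the factor 2 in the existence
      radius absorb the change from \<open>norm a\<close> to \<open>norm b\<close>.\<close>
    have "norm b \<le> 5 / 4 * norm a"
      using d1 a(2) R3 norm_triangle_ineq2[of b a] by (simp add: norm_minus_commute)
    then have "(norm b)\<^sup>2 \<le> (5 / 4 * norm a)\<^sup>2" by (intro power_mono) auto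
    also have "\<dots> \<le> 2 * (norm a)\<^sup>2" by (simp add: power_mult_distrib power2_eq_square)
    finally have "1 / (2 * (norm a)\<^sup>2) \<le> 1 / (norm b)\<^sup>2"
      using bR R3 by (intro divide_left_mono mult_pos_pos) auto
    then have "\<phi> b = a"
      using b bR a(1) by (intro \<phi>_eq) (auto simp: norm_minus_commute)
    then show ?thesis using b(1) bR by blast
  qed
  ultimately show ?thesis
    using ex1 unfolding \<phi>_def Let_def by blast
qed

end
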